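(* Let $G=(V,E)$ be a simple connected graph on nodes $1,\dots,n$ with $m$ edges and adjacency entries $a_{i,j}\in\{0,1\}$, and consider the phase dynamics $$\dot\phi_i=\sin(\phi_{t,i}-\phi_i)+\sum_{j=1}^n a'_{i,j}\sin(\phi_j-\phi_i),\qquad i=1,\dots,n,$$ with weights $$a'_{i,j}=a_{i,j}\,\frac{r_j\sin\theta_j}{r_i\sin\theta_i},\qquad 0<\theta_i<\pi,$$ so that $a'_{i,j}>0$ if $\{i,j\}\in E$ and $a'_{i,j}=0$ otherwise. Suppose that the pinner is the same for all nodes, $\phi_{t,i}=\phi^*$ for all $i$. Put $\zeta_i=\phi_i-\phi^*$, $\zeta=(\zeta_1,\dots,\zeta_n)^T$, and $\varepsilon=\max_{1\le i\le n}|\zeta_i|$ (the initial maximal deviation). If $0\le\varepsilon<\pi/2$, then the set $[-\varepsilon,\varepsilon]^n$ is positively invariant for $\zeta$, and the function $V=\tfrac12\zeta^T\zeta$ satisfies $$\dot V\le-2\mu V,\qquad \mu=\lambda_{\min}\big(\sigma_1I+\sigma_2BWB^T\big)>0,\qquad \sigma_1=\mathrm{sinc}(\varepsilon),\quad\sigma_2=\mathrm{sinc}(2\varepsilon),$$ where $B$ is the incidence matrix of $G$ and $W=\mathrm{diag}(\{a'_{i,j}\}_{\{i,j\}\in E})$ is the diagonal matrix of edge weights. Consequently all the nodes synchronize to the pinner $\phi^*$ exponentially fast, at a rate no less than $\mu$.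
   Context: These are the dynamics of the phase angles of $n$ qubits in a network; $r_i>0$, $\theta_i$, $\phi_i$ are the spherical coordinates (length, polar angle, azimuth) of the Bloch vector of qubit $i$, where the $\theta_i\in(0,\pi)$ are chosen at random, and $\phi_{t,i}$ is the target ("pinner") of node $i$. $\mathrm{sinc}(x)=\sin(x)/x$ (with value $1$ at $x=0$). With an orientation of each edge fixed, the incidence matrix $B\in\mathbb{R}^{n\times m}$ has entries $B_{i,e}=1$ if edge $e$ enters node $i$, $B_{i,e}=-1$ if $e$ leaves node $i$, and $0$ otherwise. In the paper the dynamics of $\zeta$ is written as $\dot\zeta=-\sin\zeta-BW\sin(B^T\zeta)$, with $\sin$ acting entrywise, and $BWB^T$ is taken as the (positive semidefinite) weighted Laplacian of $G$. $\lambda_{\min}$ denotes the smallest eigenvalue.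
   Formalization: For asymmetric a' the matrix W is not determined and V̇≤-2μV can fail for the displayed dynamics; that bound is stated for it only when a' is symmetric, and in general for ζ'=-sin ζ-BW sin(B^Tζ), with either a'_{i,j} or a'_{j,i} as the weight of each edge. *)

theory Defs
  imports
    "HOL-Probability.Sinc_Integral"
    "Graph_Theory.Digraph_Component"
    "Jordan_Normal_Form.Spectral_Radius"
begin

text \<open>
  Nodes are numbered \<open>0, \<dots>, n - 1\<close>. A simple undirected graph is a \<^locale>\<open>pair_graph\<close>
  (finite, loop-free, symmetric arc set), and states are vectors of dimension \<open>n\<close>.
\<close>

definition adj :: "nat pair_pre_digraph \<Rightarrow> nat \<Rightarrow> nat \<Rightarrow> real" where
  "adj G i j = (if (i, j) \<in> parcs G then 1 else 0)"

definition coupling ::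
  "nat pair_pre_digraph \<Rightarrow> (nat \<Rightarrow> real) \<Rightarrow> (nat \<Rightarrow> real) \<Rightarrow> nat \<Rightarrow> nat \<Rightarrow> real" where
  "coupling G r \<theta> i j = adj G i j * ((r j * sin (\<theta> j)) / (r i * sin (\<theta> i)))"

definition phase_field ::
  "nat \<Rightarrow> (nat \<Rightarrow> nat \<Rightarrow> real) \<Rightarrow> real vec \<Rightarrow> real vec \<Rightarrow> real vec" where
  "phase_field n a' \<phi>t \<phi> = vec n (\<lambda>i. sin (\<phi>t $ i - \<phi> $ i)
     + (\<Sum>j<n. a' i j * sin (\<phi> $ j - \<phi> $ i)))"

text \<open>
  The edges, with a fixed orientation, are enumerated as a list of pairs (tail, head);
  an edge leaves its tail and enters its head.
\<close>

definition oriented_edges :: "nat pair_pre_digraph \<Rightarrow> (nat \<times> nat) list \<Rightarrow> bool" where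
  "oriented_edges G es \<longleftrightarrow> distinct es \<and> set es \<subseteq> parcs G \<and>
     (\<forall>(i, j) \<in> parcs G. ((i, j) \<in> set es) \<noteq> ((j, i) \<in> set es))"

definition incidence :: "nat \<Rightarrow> (nat \<times> nat) list \<Rightarrow> real mat" where
  "incidence n es = mat n (length es)
     (\<lambda>(i, e). if snd (es ! e) = i then 1 else if fst (es ! e) = i then - 1 else 0)"

text \<open>
  \<open>W\<close> carries a single weight per undirected edge, whereas in general
  \<open>a' i j \<noteq> a' j i\<close>. Either of the two numbers may be chosen, independently for each edge.
  If \<open>a'\<close> is symmetric, then \<open>edge_field\<close> below is the field of the phase dynamics in the
  variable \<open>\<zeta> = \<phi> - \<phi>t\<close> (for a common pinner). Otherwise the two fields differ, and the bound on
  the derivative of \<open>V\<close> can fail for the phase dynamics, so the two are kept apart.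
\<close>

definition edge_weight_matrix ::
  "(nat \<Rightarrow> nat \<Rightarrow> real) \<Rightarrow> (nat \<times> nat) list \<Rightarrow> real mat \<Rightarrow> bool" where
  "edge_weight_matrix a' es W \<longleftrightarrow> (\<exists>w. W = mat_diag (length es) w \<and>
     (\<forall>e < length es. w e = a' (fst (es ! e)) (snd (es ! e))
                    \<or> w e = a' (snd (es ! e)) (fst (es ! e))))"

definition edge_field :: "real mat \<Rightarrow> real mat \<Rightarrow> real vec \<Rightarrow> real vec" where
  "edge_field B W \<zeta> = - map_vec sin \<zeta> - (B * W) *\<^sub>v map_vec sin (transpose_mat B *\<^sub>v \<zeta>)"

definition lambda_min :: "real mat \<Rightarrow> real" where
  "lambda_min A = Min (spectrum A)"

definition solution :: "nat \<Rightarrow> (real vec \<Rightarrow> real vec) \<Rightarrow> (real \<Rightarrow> real vec) \<Rightarrow> bool" where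
  "solution n f x \<longleftrightarrow> (\<forall>t\<ge>0. x t \<in> carrier_vec n \<and>
     (\<forall>i<n. ((\<lambda>s. x s $ i) has_real_derivative f (x t) $ i) (at t within {0..})))"

definition positively_invariant :: "nat \<Rightarrow> (real vec \<Rightarrow> real vec) \<Rightarrow> real vec set \<Rightarrow> bool" where
  "positively_invariant n f S \<longleftrightarrow>
     (\<forall>x. solution n f x \<longrightarrow> x 0 \<in> S \<longrightarrow> (\<forall>t\<ge>0. x t \<in> S))"

definition cube :: "nat \<Rightarrow> real \<Rightarrow> real vec set" where
  "cube n \<epsilon> = {z \<in> carrier_vec n. \<forall>i<n. z $ i \<in> {- \<epsilon>..\<epsilon>}}"

definition max_deviation :: "nat \<Rightarrow> real vec \<Rightarrow> real" where
  "max_deviation n z = Max ((\<lambda>i. \<bar>z $ i\<bar>) ` {..<n})"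

definition lyapunov :: "real vec \<Rightarrow> real" where
  "lyapunov z = 1 / 2 * (z \<bullet> z)"

definition lyapunov_decay :: "real \<Rightarrow> (real \<Rightarrow> real vec) \<Rightarrow> bool" where
  "lyapunov_decay \<mu> z \<longleftrightarrow> (\<forall>t\<ge>0. \<exists>D.
     ((\<lambda>s. lyapunov (z s)) has_real_derivative D) (at t within {0..}) \<and>
     D \<le> - 2 * \<mu> * lyapunov (z t))"

definition exp_convergent :: "nat \<Rightarrow> real \<Rightarrow> (real \<Rightarrow> real vec) \<Rightarrow> bool" where
  "exp_convergent n \<mu> z \<longleftrightarrow> (\<exists>C>0. \<forall>t\<ge>0. \<forall>i<n. \<bar>z t $ i\<bar> \<le> C * exp (- \<mu> * t))"

end

theory Submission
  imports Defs
begin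

text \<open>
  The all-ones vector lies in the kernel of the positive semidefinite matrix \<open>BWB\<^sup>T\<close>, so
  \<open>\<mu>\<close> is just \<open>\<sigma>1 = sinc \<epsilon>\<close>. Both fields point inwards on the faces of a
  cube of half side \<open>M < \<pi>/2\<close>, with speed at least \<open>sin M\<close>: at a node of maximal deviation
  every coupling term pulls back. Since \<open>sin M \<ge> sinc \<epsilon> * M\<close> for \<open>M \<le> \<epsilon>\<close>,
  the maximal deviation stays below the shrinking barrier \<open>\<epsilon> exp (- sinc \<epsilon> t)\<close>. This gives
  invariance and the exponential rate without the Lyapunov function, hence also for asymmetric
  couplings, where the decay of \<open>V\<close> can fail.
\<close>

unbundle no vec_syntax

section \<open>Elementary bounds for sine and sinc\<close>

lemma sin_ge_chord:
  fixes x e :: real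
  assumes "0 \<le> x" "x \<le> e" "e < pi"
  shows "sinc e * x \<le> sin x"
proof (cases "x = 0")
  case False
  have "concave_on {0..pi} sin"
    by (rule f''_le0_imp_concave[where f' = cos and f'' = "\<lambda>y. - sin y"])
       (auto intro!: derivative_eq_intros sin_ge_zero)
  \<comment> \<open>The point x is the convex combination of 0 and e with weight x / e on e, and the
    chord over [0, e] has slope \<open>sinc e\<close>.\<close>
  from concave_onD[OF this, of "x / e" 0 e] show ?thesis
    using False assms by (auto simp: field_simps)
qed simp

lemma sinc_pos:
  fixes e :: real
  assumes "\<bar>e\<bar> < pi"
  shows "0 < sinc e"
proof -
  have "0 < sin \<bar>e\<bar> / \<bar>e\<bar>" if "e \<noteq> 0"
    using assms that by (intro divide_pos_pos sin_gt_zero) auto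
  then show ?thesis
    by (cases "0 \<le> e") auto
qed

text \<open>Both sides are even in x, so the chord bound at \<open>\<bar>x\<bar>\<close> suffices.
  Summed over the nodes, it is what the pinning term contributes to the decay of V.\<close>

lemma sinc_mult_square_le:
  fixes x e :: real
  assumes "\<bar>x\<bar> \<le> e" "e < pi"
  shows "sinc e * x\<^sup>2 \<le> x * sin x"
proof -
  have "sinc e * \<bar>x\<bar> \<le> sin \<bar>x\<bar>"
    using assms by (intro sin_ge_chord) auto
  then have "\<bar>x\<bar> * (sinc e * \<bar>x\<bar>) \<le> \<bar>x\<bar> * sin \<bar>x\<bar>"
    by (rule mult_left_mono) simp
  then show ?thesis
    by (cases "0 \<le> x") (auto simp: power2_eq_square mult_ac)
qed

lemma mult_sin_nonneg:
  fixes x :: real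
  assumes "\<bar>x\<bar> \<le> pi"
  shows "0 \<le> x * sin x"
proof -
  have "0 \<le> \<bar>x\<bar> * sin \<bar>x\<bar>"
    using assms by (intro mult_nonneg_nonneg sin_ge_zero) auto
  then show ?thesis by (cases "0 \<le> x") auto
qed

section \<open>Barrier argument for inward-pointing fields\<close>

lemma first_crossing:
  fixes z :: "nat \<Rightarrow> real \<Rightarrow> real" and h :: "real \<Rightarrow> real"
  assumes cont: "\<And>i. i < n \<Longrightarrow> continuous_on {0..} (z i)" "continuous_on {0..} h"
    and init: "\<And>i. i < n \<Longrightarrow> z i 0 < h 0"
    and "k < n" "0 \<le> T" "h T \<le> z k T"
  obtains i t where "i < n" "0 < t" "z i t = h t" "\<And>j s. j < n \<Longrightarrow> 0 \<le> s \<Longrightarrow> s < t \<Longrightarrow> z j s < h s"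
    "\<And>j. j < n \<Longrightarrow> z j t \<le> h t"
proof -
  \<comment> \<open>The times at which some component has reached the barrier form a finite union of
    closed sets, so the infimum is attained and is the first contact time.\<close>
  define S where "S = (\<Union>i<n. {t \<in> {0..}. h t \<le> z i t})"
  have "closed S"
    unfolding S_def using cont
    by (intro closed_UN finite_lessThan ballI continuous_on_closed_Collect_le) auto
  moreover have ne: "S \<noteq> {}" and bdd: "bdd_below S"
    using assms unfolding S_def by (auto intro!: bdd_belowI[of _ 0])
  ultimately have "Inf S \<in> S"
    by (intro closed_contains_Inf)
  then obtain i where i: "i < n" "0 \<le> Inf S" "h (Inf S) \<le> z i (Inf S)"
    by (auto simp: S_def)
  have before: "z j s < h s" if "j < n" "0 \<le> s" "s < Inf S" for j s
  proof (rule ccontr)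
    assume "\<not> z j s < h s"
    then have "s \<in> S" using that by (force simp: S_def)
    then show False using cInf_lower[OF _ bdd] that by fastforce
  qed
  have pos: "0 < Inf S"
    using i init[of i] by (cases "Inf S = 0") auto
  have le: "z j (Inf S) \<le> h (Inf S)" if j: "j < n" for j
  proof -
    \<comment> \<open>At the contact time itself only the weak inequality survives, as the limit of
      the strict ones on [0, \<open>Inf S\<close>).\<close>
    have "closed {s \<in> {0..}. z j s \<le> h s}"
      using cont j by (intro continuous_on_closed_Collect_le) auto
    moreover have "{0..<Inf S} \<subseteq> {s \<in> {0..}. z j s \<le> h s}"
      using before[OF j] by (auto intro: less_imp_le)
    ultimately have "closure {0..<Inf S} \<subseteq> {s \<in> {0..}. z j s \<le> h s}"
      by (rule closure_minimal[rotated])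
    moreover have "Inf S \<in> closure {0..<Inf S}" using pos by simp
    ultimately show ?thesis by blast
  qed
  show thesis
    using that[OF i(1) pos _ before le] i le[OF i(1)] by auto
qed

text \<open>Every half side M below pi/2 is included, because the barrier shrinks and contact may
  occur at any of its values. This interface lets the phase field and the edge field share one
  barrier argument.\<close>

definition inward_field :: "nat \<Rightarrow> (real vec \<Rightarrow> real vec) \<Rightarrow> bool" where
  "inward_field n F \<longleftrightarrow> (\<forall>x\<in>carrier_vec n. \<forall>M. 0 < M \<longrightarrow> M < pi / 2 \<longrightarrow>
     (\<forall>j<n. \<bar>x $ j\<bar> \<le> M) \<longrightarrow>
     (\<forall>i<n. (x $ i = M \<longrightarrow> F x $ i \<le> - sin M) \<and> (x $ i = - M \<longrightarrow> sin M \<le> F x $ i)))"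

text \<open>At the first contact some component lies on a face of the cube of half side h t. Its
  modulus then decreases at speed at least sin (h t), which exceeds the speed \<kappa> * h t of the
  barrier, so it must have been above the barrier just before.\<close>

lemma inward_field_strict_bound:
  fixes e \<kappa> :: real
  assumes F: "inward_field n F" and sol: "solution n F x"
    and e: "0 < e" "e < pi / 2" and \<kappa>: "0 \<le> \<kappa>" "\<kappa> < sinc e"
    and init: "\<And>i. i < n \<Longrightarrow> \<bar>x 0 $ i\<bar> < e"
    and k: "k < n" "0 \<le> T"
  shows "\<bar>x T $ k\<bar> < e * exp (- \<kappa> * T)"
proof (rule ccontr)
  define h where "h t = e * exp (- \<kappa> * t)" for t
  assume "\<not> \<bar>x T $ k\<bar> < e * exp (- \<kappa> * T)"
  then have viol: "h T \<le> \<bar>x T $ k\<bar>" by (simp add: h_def)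
  have der: "((\<lambda>s. x s $ i) has_real_derivative F (x t) $ i) (at t within {0..})"
    if "i < n" "0 \<le> t" for i t
    using sol that by (auto simp: solution_def)
  have hder: "(h has_real_derivative - \<kappa> * h t) (at t within {0..})" for t
    unfolding h_def by (auto intro!: derivative_eq_intros)
  have "continuous_on {0..} (\<lambda>s. \<bar>x s $ i\<bar>)" if "i < n" for i
    using der[OF that] by (intro continuous_on_rabs DERIV_continuous_on) auto
  moreover have "continuous_on {0..} h"
    using hder by (rule DERIV_continuous_on)
  ultimately obtain i t where i: "i < n" "0 < t" and eq: "\<bar>x t $ i\<bar> = h t"
    and before: "\<And>j s. j < n \<Longrightarrow> 0 \<le> s \<Longrightarrow> s < t \<Longrightarrow> \<bar>x s $ j\<bar> < h s"
    and le: "\<And>j. j < n \<Longrightarrow> \<bar>x t $ j\<bar> \<le> h t"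
    using first_crossing[of n "\<lambda>i s. \<bar>x s $ i\<bar>" h k T] init k viol
    by (auto simp: h_def)
  \<comment> \<open>A nonnegative \<kappa> keeps the barrier below e, so that the chord bound with
    slope \<open>sinc e\<close> applies at h t.\<close>
  have h_pos: "0 < h t" and h_le: "h t \<le> e"
    using e \<kappa> i by (auto simp: h_def mult_le_cancel_left1)
  have carr: "x t \<in> carrier_vec n"
    using sol i by (auto simp: solution_def)
  have "sinc e * h t \<le> sin (h t)"
    using h_pos h_le e by (intro sin_ge_chord) auto
  moreover have "\<kappa> * h t < sinc e * h t"
    using \<kappa> h_pos by (intro mult_strict_right_mono) auto
  ultimately have strict: "\<kappa> * h t < sin (h t)" by linarith
  \<comment> \<open>The sign \<open>c\<close> treats the upper and the lower face at once.\<close>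
  have contact: False
    if c: "\<bar>c\<bar> = 1" "c * x t $ i = h t" and D: "c * F (x t) $ i \<le> - sin (h t)" for c
  proof -
    have "((\<lambda>s. c * x s $ i - h s) has_real_derivative c * F (x t) $ i - (- \<kappa> * h t)) (at t within {0..})"
      using i by (intro derivative_intros der hder DERIV_cmult) auto
    moreover have "c * F (x t) $ i - (- \<kappa> * h t) < 0"
      using D strict by simp
    ultimately obtain d where d: "d > 0" and
      dec: "\<And>u. u > 0 \<Longrightarrow> t - u \<in> {0..} \<Longrightarrow> u < d \<Longrightarrow> c * x t $ i - h t < c * x (t - u) $ i - h (t - u)"
      using has_real_derivative_neg_dec_left by blast
    \<comment> \<open>Halving the minimum gives u < d, where the derivative has control, and u < t,
      so that t - u is a time before the first contact.\<close>
    define u where "u = min d t / 2"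
    have u: "0 < u" "u < d" "u < t" using d i by (auto simp: u_def min_def)
    have "0 < c * x (t - u) $ i - h (t - u)"
      using dec[of u] u c by auto
    moreover have "c * x (t - u) $ i \<le> \<bar>x (t - u) $ i\<bar>"
      using c(1) by (metis abs_ge_self abs_mult mult_1)
    ultimately show False using before[of i "t - u"] u i by auto
  qed
  have inw: "(x t $ i = h t \<longrightarrow> F (x t) $ i \<le> - sin (h t)) \<and>
      (x t $ i = - h t \<longrightarrow> sin (h t) \<le> F (x t) $ i)"
    using F carr h_pos h_le e le i unfolding inward_field_def by auto
  show False
  proof (cases "0 \<le> x t $ i")
    case True
    then show False using contact[of 1] inw eq by auto
  next
    case False
    then show False using contact[of "-1"] inw eq by auto
  qed
qed

lemma inward_field_bound:
  fixes \<epsilon> :: real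
  assumes F: "inward_field n F" and sol: "solution n F x"
    and e: "0 \<le> \<epsilon>" "\<epsilon> < pi / 2"
    and init: "\<And>i. i < n \<Longrightarrow> \<bar>x 0 $ i\<bar> \<le> \<epsilon>"
    and k: "k < n" "0 \<le> t"
  shows "\<bar>x t $ k\<bar> \<le> \<epsilon> * exp (- sinc \<epsilon> * t)"
proof -
  \<comment> \<open>Strict barriers need slack in both the radius and the rate; let it tend to \<open>0\<close>.\<close>
  have lim: "((\<lambda>d. d) \<longlongrightarrow> 0) (at_right (0::real))"
    by (rule tendsto_ident_at)
  have "((\<lambda>d. \<epsilon> + d) \<longlongrightarrow> \<epsilon>) (at_right 0)"
    using tendsto_add[OF tendsto_const lim, of \<epsilon>] by simp
  then have lim_sinc: "((\<lambda>d. sinc (\<epsilon> + d)) \<longlongrightarrow> sinc \<epsilon>) (at_right 0)"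
    by (rule isCont_tendsto_compose[OF isCont_sinc])
  have "((\<lambda>d. (\<epsilon> + d) * exp (- (sinc (\<epsilon> + d) - d) * t)) \<longlongrightarrow> (\<epsilon> + 0) * exp (- (sinc \<epsilon> - 0) * t)) (at_right 0)"
    by (intro tendsto_intros lim lim_sinc)
  moreover have "eventually (\<lambda>d. \<bar>x t $ k\<bar> \<le> (\<epsilon> + d) * exp (- (sinc (\<epsilon> + d) - d) * t)) (at_right 0)"
  proof -
    \<comment> \<open>The strict bound is used with radius \<epsilon> + d, which is positive even
      for \<epsilon> = 0, and with rate sinc (\<epsilon> + d) - d. This rate is positive for small d
      because its limit is.\<close>
    have "((\<lambda>d. sinc (\<epsilon> + d) - d) \<longlongrightarrow> sinc \<epsilon> - 0) (at_right 0)"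
      by (intro tendsto_intros lim lim_sinc)
    moreover have "sinc \<epsilon> - 0 > 0"
      using sinc_pos[of \<epsilon>] e by auto
    ultimately have "eventually (\<lambda>d. 0 < sinc (\<epsilon> + d) - d) (at_right 0)"
      by (rule order_tendstoD)
    moreover have "eventually (\<lambda>d. d < pi / 2 - \<epsilon>) (at_right 0)"
      using e by (intro order_tendstoD[OF lim]) auto
    moreover have "eventually (\<lambda>d::real. 0 < d) (at_right 0)"
      by (rule eventually_at_right_less)
    ultimately show ?thesis
    proof eventually_elim
      case (elim d)
      have "\<bar>x 0 $ i\<bar> < \<epsilon> + d" if "i < n" for i
        using init[OF that] elim by linarith
      then show ?case
        using elim e k
        by (intro less_imp_le[OF inward_field_strict_bound[OF F sol]]) auto
    qed
  qed
  ultimately show ?thesis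
    using tendsto_lowerbound[of _ _ "at_right (0::real)"] by fastforce
qed

lemma inward_field_positively_invariant:
  assumes F: "inward_field n F" and \<epsilon>: "0 \<le> \<epsilon>" "\<epsilon> < pi / 2"
  shows "positively_invariant n F (cube n \<epsilon>)"
  unfolding positively_invariant_def
proof (intro allI impI)
  fix x :: "real \<Rightarrow> real vec" and t :: real
  assume sol: "solution n F x" and init: "x 0 \<in> cube n \<epsilon>" and t: "0 \<le> t"
  have "\<bar>x t $ i\<bar> \<le> \<epsilon>" if i: "i < n" for i
  proof -
    have "\<bar>x t $ i\<bar> \<le> \<epsilon> * exp (- sinc \<epsilon> * t)"
      using init i t by (intro inward_field_bound[OF F sol \<epsilon>]) (auto simp: cube_def abs_le_iff)
    also have "\<dots> \<le> \<epsilon> * 1"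
      using \<epsilon> t sinc_pos[of \<epsilon>] by (intro mult_left_mono) auto
    finally show ?thesis by simp
  qed
  moreover have "x t \<in> carrier_vec n"
    using sol t by (auto simp: solution_def)
  ultimately show "x t \<in> cube n \<epsilon>"
    by (force simp: cube_def abs_le_iff)
qed

lemma max_deviation_cube:
  assumes "z \<in> carrier_vec n"
  shows "z \<in> cube n (max_deviation n z)"
proof -
  have "\<bar>z $ i\<bar> \<le> max_deviation n z" if "i < n" for i
    unfolding max_deviation_def using that by (intro Max_ge) auto
  then show ?thesis
    using assms by (force simp: cube_def abs_le_iff)
qed

lemma inward_field_exp_convergent:
  assumes F: "inward_field n F" and \<epsilon>: "0 \<le> \<epsilon>" "\<epsilon> < pi / 2"
    and sol: "solution n F x" and init: "x 0 \<in> cube n \<epsilon>"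
  shows "exp_convergent n (sinc \<epsilon>) x"
  unfolding exp_convergent_def
\<comment> \<open>The constant is \<epsilon> + 1 because \<open>exp_convergent\<close> asks for a
  positive one and \<epsilon> may be 0.\<close>
proof (intro exI[of _ "\<epsilon> + 1"] conjI allI impI)
  fix t :: real and i
  assume t: "0 \<le> t" and i: "i < n"
  have "\<bar>x t $ i\<bar> \<le> \<epsilon> * exp (- sinc \<epsilon> * t)"
    using init i t by (intro inward_field_bound[OF F sol \<epsilon>]) (auto simp: cube_def abs_le_iff)
  also have "\<dots> \<le> (\<epsilon> + 1) * exp (- sinc \<epsilon> * t)"
    by (intro mult_right_mono) auto
  finally show "\<bar>x t $ i\<bar> \<le> (\<epsilon> + 1) * exp (- sinc \<epsilon> * t)" .
qed (use \<epsilon> in auto)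

text \<open>The derivative of V along a solution is the inner product of \<open>z t\<close> and
  \<open>F (z t)\<close>, so decay reduces to a pointwise inequality on a set that holds the
  trajectory.\<close>

lemma lyapunov_decayI:
  assumes sol: "solution n F z" and cube: "\<And>t. 0 \<le> t \<Longrightarrow> z t \<in> S"
    and dissip: "\<And>x. x \<in> S \<Longrightarrow> (\<Sum>i<n. x $ i * F x $ i) \<le> - \<mu> * (\<Sum>i<n. (x $ i)\<^sup>2)"
  shows "lyapunov_decay \<mu> z"
  unfolding lyapunov_decay_def
proof (intro allI impI exI conjI)
  fix t :: real assume t: "0 \<le> t"
  have lyap: "lyapunov (z s) = 1 / 2 * (\<Sum>i<n. (z s $ i)\<^sup>2)" if "0 \<le> s" for s
    using sol that
    by (auto simp: solution_def lyapunov_def scalar_prod_def power2_eq_square lessThan_atLeast0)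
  have der: "((\<lambda>s. z s $ i) has_real_derivative F (z t) $ i) (at t within {0..})" if "i < n" for i
    using sol that t by (auto simp: solution_def)
  have D: "((\<lambda>s. 1 / 2 * (\<Sum>i<n. (z s $ i)\<^sup>2)) has_real_derivative
      1 / 2 * (\<Sum>i<n. 2 * (z t $ i * F (z t) $ i))) (at t within {0..})"
    by (intro DERIV_cmult DERIV_sum) (auto intro!: derivative_eq_intros der)
  have "1 / 2 * (\<Sum>i<n. 2 * (z t $ i * F (z t) $ i)) = (\<Sum>i<n. z t $ i * F (z t) $ i)"
    by (simp add: sum_distrib_left[symmetric])
  then show "((\<lambda>s. lyapunov (z s)) has_real_derivative (\<Sum>i<n. z t $ i * F (z t) $ i)) (at t within {0..})"
    \<comment> \<open>The sum formula for V is known only at times s >= 0, where the state has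
      dimension n; this suffices for a derivative within \<open>{0..}\<close>. The radius 1 is
      arbitrary.\<close>
    using t
    by (intro has_field_derivative_transform_within[OF DERIV_cong[OF D], where d = 1])
       (auto simp: lyap)
  show "(\<Sum>i<n. z t $ i * F (z t) $ i) \<le> - 2 * \<mu> * lyapunov (z t)"
    using dissip[OF cube[OF t]] unfolding lyap[OF t] by simp
qed

section \<open>The phase dynamics relative to the pinner\<close>

lemma phase_field_shift:
  assumes "\<phi>t \<in> carrier_vec n" "\<And>i. i < n \<Longrightarrow> \<phi>t $ i = \<phi>star" "\<phi> \<in> carrier_vec n"
  shows "phase_field n a \<phi>t \<phi> = phase_field n a (0\<^sub>v n) (\<phi> - \<phi>t)"
  \<comment> \<open>The common pinner value cancels in every difference of two phases.\<close>
  using assms by (intro eq_vecI) (auto simp: phase_field_def intro!: sum.cong)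

lemma phase_field_solution_shift:
  assumes "\<phi>t \<in> carrier_vec n" "\<And>i. i < n \<Longrightarrow> \<phi>t $ i = \<phi>star"
    and sol: "solution n (phase_field n a \<phi>t) \<phi>"
  shows "solution n (phase_field n a (0\<^sub>v n)) (\<lambda>t. \<phi> t - \<phi>t)"
  unfolding solution_def
proof (intro allI impI conjI)
  fix t :: real assume t: "0 \<le> t"
  have carr: "\<phi> s \<in> carrier_vec n" if "0 \<le> s" for s
    using sol that by (auto simp: solution_def)
  then show "\<phi> t - \<phi>t \<in> carrier_vec n"
    using assms t by auto
  fix i assume i: "i < n"
  have "((\<lambda>s. \<phi> s $ i) has_real_derivative phase_field n a \<phi>t (\<phi> t) $ i) (at t within {0..})"
    using sol t i by (auto simp: solution_def)
  then have "((\<lambda>s. \<phi> s $ i - \<phi>t $ i) has_real_derivative phase_field n a \<phi>t (\<phi> t) $ i - 0) (at t within {0..})"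
    by (intro DERIV_diff) auto
  then have "((\<lambda>s. (\<phi> s - \<phi>t) $ i) has_real_derivative phase_field n a \<phi>t (\<phi> t) $ i) (at t within {0..})"
    using assms(1) i t by simp
  then show "((\<lambda>s. (\<phi> s - \<phi>t) $ i) has_real_derivative
      phase_field n a (0\<^sub>v n) (\<phi> t - \<phi>t) $ i) (at t within {0..})"
    using phase_field_shift[OF assms(1,2) carr[OF t]] by simp
qed

text \<open>On the face \<open>x $ i = M\<close> the differences \<open>x $ j - M\<close> lie in
  [-2M, 0]. As 2M < pi, their sines are nonpositive, so the coupling only adds to the pinning term -
  sin M. The opposite face is symmetric.\<close>

lemma phase_field_inward:
  assumes a: "\<And>i j. i < n \<Longrightarrow> j < n \<Longrightarrow> 0 \<le> a i j"
  shows "inward_field n (phase_field n a (0\<^sub>v n))"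
  unfolding inward_field_def
proof (intro ballI allI impI conjI)
  fix x :: "real vec" and M :: real and i
  assume x: "x \<in> carrier_vec n" and M: "0 < M" "M < pi / 2" and i: "i < n"
    and le: "\<forall>j<n. \<bar>x $ j\<bar> \<le> M"
  have b: "- M \<le> x $ j \<and> x $ j \<le> M" if "j < n" for j
    using le that by (metis abs_le_iff minus_le_iff)
  show "phase_field n a (0\<^sub>v n) x $ i \<le> - sin M" if "x $ i = M"
  proof -
    have "0 \<le> sin (M - x $ j)" if "j < n" for j
      using b[OF that] M by (intro sin_ge_zero) linarith+
    then have "a i j * sin (x $ j - M) \<le> 0" if "j < n" for j
      using a[OF i that] that sin_minus[of "M - x $ j"]
      by (intro mult_nonneg_nonpos) auto
    then have "(\<Sum>j<n. a i j * sin (x $ j - M)) \<le> 0"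
      by (intro sum_nonpos) auto
    then show ?thesis using i that by (simp add: phase_field_def)
  qed
  show "sin M \<le> phase_field n a (0\<^sub>v n) x $ i" if "x $ i = - M"
  proof -
    have "0 \<le> sin (x $ j + M)" if "j < n" for j
      using b[OF that] M by (intro sin_ge_zero) linarith+
    then have "0 \<le> (\<Sum>j<n. a i j * sin (x $ j + M))"
      using a i by (intro sum_nonneg mult_nonneg_nonneg) auto
    then show ?thesis using i that by (simp add: phase_field_def)
  qed
qed

lemma sum_mult_sin_ge:
  assumes "x \<in> cube n \<epsilon>" "\<epsilon> < pi / 2"
  shows "sinc \<epsilon> * (\<Sum>i<n. (x $ i)\<^sup>2) \<le> (\<Sum>i<n. x $ i * sin (x $ i))"
  unfolding sum_distrib_left
proof (intro sum_mono sinc_mult_square_le)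
  fix i assume "i \<in> {..<n}"
  then have "- \<epsilon> \<le> x $ i" "x $ i \<le> \<epsilon>" using assms by (auto simp: cube_def)
  then show "\<bar>x $ i\<bar> \<le> \<epsilon>" "\<epsilon> < pi" using assms by auto
qed

text \<open>Symmetric weights make s antisymmetric. Averaging the double sum with its transpose
  turns the coupling part into -1/2 times a sum of terms a d sin d with |d| <= 2\<epsilon> < pi, all
  nonnegative. Only the pinning part remains to be estimated.\<close>

lemma phase_field_dissipation:
  assumes a: "\<And>i j. i < n \<Longrightarrow> j < n \<Longrightarrow> 0 \<le> a i j"
    and sym: "\<And>i j. i < n \<Longrightarrow> j < n \<Longrightarrow> a i j = a j i"
    and x: "x \<in> cube n \<epsilon>" and \<epsilon>: "\<epsilon> < pi / 2"
  shows "(\<Sum>i<n. x $ i * phase_field n a (0\<^sub>v n) x $ i) \<le> - sinc \<epsilon> * (\<Sum>i<n. (x $ i)\<^sup>2)"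
proof -
  define s where "s i j = a i j * sin (x $ j - x $ i)" for i j
  have b: "- \<epsilon> \<le> x $ i" "x $ i \<le> \<epsilon>" if "i < n" for i
    using x that by (auto simp: cube_def)
  have anti: "s j i = - s i j" if "i < n" "j < n" for i j
    using sym[OF that] sin_minus[of "x $ j - x $ i"] by (simp add: s_def)
  have "(\<Sum>i<n. \<Sum>j<n. x $ i * s i j) = (\<Sum>i<n. \<Sum>j<n. x $ j * s j i)"
    by (rule sum.swap)
  also have "\<dots> = - (\<Sum>i<n. \<Sum>j<n. x $ j * s i j)"
    unfolding sum_negf[symmetric] by (intro sum.cong refl) (metis anti lessThan_iff mult_minus_right)
  finally have "2 * (\<Sum>i<n. \<Sum>j<n. x $ i * s i j) = - (\<Sum>i<n. \<Sum>j<n. (x $ j - x $ i) * s i j)"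
    by (simp add: left_diff_distrib sum_subtractf)
  moreover have "0 \<le> (x $ j - x $ i) * s i j" if "i < n" "j < n" for i j
  proof -
    have "0 \<le> (x $ j - x $ i) * sin (x $ j - x $ i)"
      using b[OF that(1)] b[OF that(2)] \<epsilon> by (intro mult_sin_nonneg) linarith
    then have "0 \<le> a i j * ((x $ j - x $ i) * sin (x $ j - x $ i))"
      using a that by simp
    then show ?thesis by (simp add: s_def mult_ac)
  qed
  then have "0 \<le> (\<Sum>i<n. \<Sum>j<n. (x $ j - x $ i) * s i j)"
    by (intro sum_nonneg) auto
  ultimately have "(\<Sum>i<n. \<Sum>j<n. x $ i * s i j) \<le> 0" by linarith
  moreover have "(\<Sum>i<n. x $ i * phase_field n a (0\<^sub>v n) x $ i) =
      (\<Sum>i<n. (\<Sum>j<n. x $ i * s i j) - x $ i * sin (x $ i))"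
    by (intro sum.cong) (simp_all add: phase_field_def s_def sum_distrib_left[symmetric] right_diff_distrib)
  then have "(\<Sum>i<n. x $ i * phase_field n a (0\<^sub>v n) x $ i) =
      (\<Sum>i<n. \<Sum>j<n. x $ i * s i j) - (\<Sum>i<n. x $ i * sin (x $ i))"
    by (simp only: sum_subtractf)
  ultimately show ?thesis
    using sum_mult_sin_ge[OF x \<epsilon>] by linarith
qed

section \<open>Incidence matrix, weighted Laplacian and edge field\<close>

lemma smult_mat_mult_vec:
  assumes "A \<in> carrier_mat nr nc" "v \<in> carrier_vec nc"
  shows "(k \<cdot>\<^sub>m A) *\<^sub>v v = k \<cdot>\<^sub>v (A *\<^sub>v v)"
  using assms by (intro eq_vecI) (auto simp: scalar_prod_def sum_distrib_left mult.assoc)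

text \<open>Only loop-free edges between valid nodes and nonnegative weights are retained from the
  graph, so the results cover every choice of weights that \<open>edge_weight_matrix\<close>
  allows.\<close>

locale weighted_incidence =
  fixes n :: nat and es :: "(nat \<times> nat) list" and w :: "nat \<Rightarrow> real"
  assumes ends: "e < length es \<Longrightarrow> fst (es ! e) < n \<and> snd (es ! e) < n \<and> fst (es ! e) \<noteq> snd (es ! e)"
    and weight_nonneg: "e < length es \<Longrightarrow> 0 \<le> w e"
begin

abbreviation "B \<equiv> incidence n es"
abbreviation "W \<equiv> mat_diag (length es) w"

lemma B_carrier [simp]: "B \<in> carrier_mat n (length es)"
  by (simp add: incidence_def)

lemma B_dims [simp]: "dim_row B = n" "dim_col B = length es"
  using B_carrier unfolding carrier_mat_def by blast+

lemma B_transpose_mult: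
  assumes "x \<in> carrier_vec n" "e < length es"
  shows "(transpose_mat B *\<^sub>v x) $ e = x $ snd (es ! e) - x $ fst (es ! e)"
proof -
  have "(transpose_mat B *\<^sub>v x) $ e = (\<Sum>i<n. B $$ (i, e) * x $ i)"
    using assms by (auto simp: scalar_prod_def lessThan_atLeast0)
  \<comment> \<open>Distinct endpoints matter here: \<open>incidence\<close> tests the head first,
    so a loop would get the entry 1 instead of 0.\<close>
  also have "\<dots> = (\<Sum>i<n. (if i = snd (es ! e) then x $ i else 0) - (if i = fst (es ! e) then x $ i else 0))"
    using assms(2) ends[OF assms(2)] by (intro sum.cong) (auto simp: incidence_def)
  also have "\<dots> = x $ snd (es ! e) - x $ fst (es ! e)"
    using ends[OF assms(2)] by (simp add: sum_subtractf)
  finally show ?thesis .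
qed

lemma BW_mult:
  assumes "y \<in> carrier_vec (length es)" "i < n"
  shows "((B * W) *\<^sub>v y) $ i = (\<Sum>e<length es. B $$ (i, e) * (w e * y $ e))"
  using assms
  by (auto simp: mat_diag_mult_right[of _ n] scalar_prod_def lessThan_atLeast0 intro!: sum.cong)

text \<open>Moving B to the other side of the inner product leaves one term per edge. The case
  \<open>y = transpose_mat B *\<^sub>v x\<close> gives the Laplacian form, and its entrywise sine
  gives the edge field.\<close>

lemma quadratic_form:
  assumes x: "x \<in> carrier_vec n" and y: "y \<in> carrier_vec (length es)"
  shows "(\<Sum>i<n. x $ i * ((B * W) *\<^sub>v y) $ i)
    = (\<Sum>e<length es. w e * ((x $ snd (es ! e) - x $ fst (es ! e)) * y $ e))"
proof -
  have "(\<Sum>i<n. x $ i * ((B * W) *\<^sub>v y) $ i)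
      = (\<Sum>i<n. \<Sum>e<length es. B $$ (i, e) * x $ i * (w e * y $ e))"
    by (intro sum.cong) (simp_all add: BW_mult[OF y] sum_distrib_left mult_ac del: index_mult_mat_vec)
  also have "\<dots> = (\<Sum>e<length es. \<Sum>i<n. B $$ (i, e) * x $ i * (w e * y $ e))"
    by (rule sum.swap)
  also have "\<dots> = (\<Sum>e<length es. (transpose_mat B *\<^sub>v x) $ e * (w e * y $ e))"
    using x by (intro sum.cong) (auto simp: scalar_prod_def lessThan_atLeast0 sum_distrib_right)
  also have "\<dots> = (\<Sum>e<length es. w e * ((x $ snd (es ! e) - x $ fst (es ! e)) * y $ e))"
    by (intro sum.cong) (simp_all add: B_transpose_mult[OF x] mult_ac del: index_mult_mat_vec)
  finally show ?thesis .
qed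

text \<open>The all-ones vector realizes the eigenvalue \<sigma>1. For any eigenpair (k, v), pairing
  \<open>A *\<^sub>v v\<close> with v gives k |v|^2 = \<sigma>1 |v|^2 plus \<sigma>2 times a
  weighted sum of squares, hence k >= \<sigma>1.\<close>

lemma lambda_min_eq:
  assumes n: "0 < n" and \<sigma>2: "0 \<le> \<sigma>2"
  shows "lambda_min (\<sigma>1 \<cdot>\<^sub>m 1\<^sub>m n + \<sigma>2 \<cdot>\<^sub>m (B * W * transpose_mat B)) = \<sigma>1"
proof -
  define A where "A = \<sigma>1 \<cdot>\<^sub>m 1\<^sub>m n + \<sigma>2 \<cdot>\<^sub>m (B * W * transpose_mat B)"
  have BW: "B * W \<in> carrier_mat n (length es)"
    by (rule mult_carrier_mat[OF B_carrier mat_diag_dim])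
  have L: "B * W * transpose_mat B \<in> carrier_mat n n"
    by (rule mult_carrier_mat[OF BW]) simp
  have A: "A \<in> carrier_mat n n" using L by (simp add: A_def)
  have Bx: "transpose_mat B *\<^sub>v x \<in> carrier_vec (length es)" for x
    by (rule carrier_vecI) simp
  have A_mult: "(A *\<^sub>v x) $ i = \<sigma>1 * x $ i + \<sigma>2 * ((B * W) *\<^sub>v (transpose_mat B *\<^sub>v x)) $ i"
    if x: "x \<in> carrier_vec n" and i: "i < n" for x i
  proof -
    have "A *\<^sub>v x = (\<sigma>1 \<cdot>\<^sub>m 1\<^sub>m n) *\<^sub>v x + (\<sigma>2 \<cdot>\<^sub>m (B * W * transpose_mat B)) *\<^sub>v x"
      unfolding A_def by (intro add_mult_distrib_mat_vec[OF _ smult_carrier_mat[OF L] x]) simp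
    also have "\<dots> = \<sigma>1 \<cdot>\<^sub>v x + \<sigma>2 \<cdot>\<^sub>v ((B * W * transpose_mat B) *\<^sub>v x)"
      by (simp only: smult_mat_mult_vec[OF L x] smult_mat_mult_vec[OF one_carrier_mat x] one_mult_mat_vec[OF x])
    also have "(B * W * transpose_mat B) *\<^sub>v x = (B * W) *\<^sub>v (transpose_mat B *\<^sub>v x)"
      using x by (intro assoc_mult_mat_vec[OF BW]) auto
    finally show ?thesis using x i by simp
  qed
  let ?u = "vec n (\<lambda>_. 1::real)"
  have "eigenvector A (?u) \<sigma>1"
    unfolding eigenvector_def
  proof (intro conjI)
    show "?u \<in> carrier_vec (dim_row A)"
      using A by auto
    have "?u $ 0 \<noteq> 0\<^sub>v n $ 0" using n by simp
    then show "?u \<noteq> 0\<^sub>v (dim_row A)" using A by (metis carrier_matD(1))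
    \<comment> \<open>Each edge takes the difference of two equal entries.\<close>
    have "transpose_mat B *\<^sub>v ?u = 0\<^sub>v (length es)"
      using ends by (intro eq_vecI) (simp_all add: B_transpose_mult del: index_mult_mat_vec)
    moreover have "((B * W) *\<^sub>v 0\<^sub>v (length es)) $ i = 0" if "i < n" for i
      using that by (simp add: BW_mult del: index_mult_mat_vec)
    ultimately show "A *\<^sub>v ?u = \<sigma>1 \<cdot>\<^sub>v ?u"
      using A by (intro eq_vecI) (simp_all add: A_mult del: index_mult_mat_vec)
  qed
  then have mem: "\<sigma>1 \<in> spectrum A"
    by (auto simp: spectrum_def eigenvalue_def)
  have "\<sigma>1 \<le> k" if k: "k \<in> spectrum A" for k
  proof -
    obtain v where v: "v \<in> carrier_vec n" "v \<noteq> 0\<^sub>v n" "A *\<^sub>v v = k \<cdot>\<^sub>v v"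
      using k A by (auto simp: spectrum_def eigenvalue_def eigenvector_def)
    have "k * (\<Sum>i<n. (v $ i)\<^sup>2) = (\<Sum>i<n. v $ i * (A *\<^sub>v v) $ i)"
      using v by (simp add: sum_distrib_left power2_eq_square mult_ac del: index_mult_mat_vec)
    also have "\<dots> = \<sigma>1 * (\<Sum>i<n. (v $ i)\<^sup>2) + \<sigma>2 * (\<Sum>i<n. v $ i * ((B * W) *\<^sub>v (transpose_mat B *\<^sub>v v)) $ i)"
      by (simp add: A_mult[OF v(1)] sum_distrib_left sum.distrib power2_eq_square distrib_left
          mult.left_commute del: index_mult_mat_vec)
    also have "(\<Sum>i<n. v $ i * ((B * W) *\<^sub>v (transpose_mat B *\<^sub>v v)) $ i)
        = (\<Sum>e<length es. w e * (v $ snd (es ! e) - v $ fst (es ! e))\<^sup>2)"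
      unfolding quadratic_form[OF v(1) Bx]
      by (intro sum.cong) (simp_all add: B_transpose_mult[OF v(1)] power2_eq_square del: index_mult_mat_vec)
    finally have "\<sigma>1 * (\<Sum>i<n. (v $ i)\<^sup>2) \<le> k * (\<Sum>i<n. (v $ i)\<^sup>2)"
      using \<sigma>2 weight_nonneg by (auto intro!: mult_nonneg_nonneg sum_nonneg)
    moreover obtain i where i: "i < n" "v $ i \<noteq> 0"
      using v by (metis carrier_vecD eq_vecI index_zero_vec(1,2))
    have "0 < (\<Sum>i<n. (v $ i)\<^sup>2)"
      using i by (intro sum_pos2[of _ i]) auto
    ultimately show "\<sigma>1 \<le> k" by simp
  qed
  then show ?thesis
    unfolding lambda_min_def A_def[symmetric]
    using card_finite_spectrum(1)[OF A] mem by (intro Min_eqI) auto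
qed

lemma edge_field_index:
  assumes "x \<in> carrier_vec n" "i < n"
  shows "edge_field B W x $ i = - sin (x $ i)
    - ((B * W) *\<^sub>v map_vec sin (transpose_mat B *\<^sub>v x)) $ i"
  using assms by (simp add: edge_field_def del: index_mult_mat_vec)

lemma edge_field_sum:
  assumes "x \<in> carrier_vec n" "i < n"
  shows "edge_field B W x $ i = - sin (x $ i)
    - (\<Sum>e<length es. B $$ (i, e) * (w e * sin (x $ snd (es ! e) - x $ fst (es ! e))))"
proof -
  have "map_vec sin (transpose_mat B *\<^sub>v x) \<in> carrier_vec (length es)"
    by (rule carrier_vecI) simp
  from BW_mult[OF this assms(2)] show ?thesis
    using assms by (simp add: edge_field_index B_transpose_mult del: index_mult_mat_vec)
qed

text \<open>At a node with value M, an edge entering it has sign +1 and a nonnegative sine, while an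
  edge leaving it has sign -1 and a nonpositive sine. The contribution is thus nonnegative for
  either orientation; at -M all signs flip.\<close>

lemma edge_field_inward: "inward_field n (edge_field B W)"
  unfolding inward_field_def
proof (intro ballI allI impI conjI)
  fix x :: "real vec" and M :: real and i
  assume x: "x \<in> carrier_vec n" and M: "0 < M" "M < pi / 2" and i: "i < n"
    and le: "\<forall>j<n. \<bar>x $ j\<bar> \<le> M"
  have b: "- M \<le> x $ j \<and> x $ j \<le> M" if "j < n" for j
    using le that by (metis abs_le_iff minus_le_iff)
  show "edge_field B W x $ i \<le> - sin M" if c: "x $ i = M"
  proof -
    have "0 \<le> B $$ (i, e) * (w e * sin (x $ snd (es ! e) - x $ fst (es ! e)))"
      if e: "e < length es" for e
    proof -
      have "0 \<le> sin (M - x $ fst (es ! e))" "0 \<le> sin (M - x $ snd (es ! e))"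
        using b[of "fst (es ! e)"] b[of "snd (es ! e)"] ends[OF e] M
        by (auto intro!: sin_ge_zero)
      then show ?thesis
        using ends[OF e] weight_nonneg[OF e] e i c sin_minus[of "M - x $ snd (es ! e)"]
        by (auto simp: incidence_def mult_nonneg_nonpos)
    qed
    then have "0 \<le> (\<Sum>e<length es. B $$ (i, e) * (w e * sin (x $ snd (es ! e) - x $ fst (es ! e))))"
      by (intro sum_nonneg) auto
    then show ?thesis using edge_field_sum[OF x i] c by simp
  qed
  show "sin M \<le> edge_field B W x $ i" if c: "x $ i = - M"
  proof -
    have "B $$ (i, e) * (w e * sin (x $ snd (es ! e) - x $ fst (es ! e))) \<le> 0"
      if e: "e < length es" for e
    proof -
      have "0 \<le> sin (M + x $ fst (es ! e))" "0 \<le> sin (M + x $ snd (es ! e))"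
        using b[of "fst (es ! e)"] b[of "snd (es ! e)"] ends[OF e] M
        by (auto intro!: sin_ge_zero)
      then show ?thesis
        using ends[OF e] weight_nonneg[OF e] e i c sin_minus[of "M + x $ fst (es ! e)"]
        by (auto simp: incidence_def mult_nonneg_nonpos add.commute)
    qed
    then have "(\<Sum>e<length es. B $$ (i, e) * (w e * sin (x $ snd (es ! e) - x $ fst (es ! e)))) \<le> 0"
      by (intro sum_nonpos) auto
    then show ?thesis using edge_field_sum[OF x i] c by simp
  qed
qed

text \<open>A single weight per edge provides the symmetry: by \<open>quadratic_form\<close> each
  edge contributes w d sin d to the coupling form, where |d| <= 2\<epsilon> < pi.\<close>

lemma edge_field_dissipation:
  assumes x: "x \<in> cube n \<epsilon>" and \<epsilon>: "\<epsilon> < pi / 2"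
  shows "(\<Sum>i<n. x $ i * edge_field B W x $ i) \<le> - sinc \<epsilon> * (\<Sum>i<n. (x $ i)\<^sup>2)"
proof -
  let ?y = "map_vec sin (transpose_mat B *\<^sub>v x)"
  have carr: "x \<in> carrier_vec n" and b: "\<And>i. i < n \<Longrightarrow> - \<epsilon> \<le> x $ i \<and> x $ i \<le> \<epsilon>"
    using x by (auto simp: cube_def)
  have y: "?y \<in> carrier_vec (length es)"
    by (rule carrier_vecI) simp
  have "0 \<le> w e * ((x $ snd (es ! e) - x $ fst (es ! e)) * ?y $ e)" if e: "e < length es" for e
  proof -
    have "0 \<le> (x $ snd (es ! e) - x $ fst (es ! e)) * sin (x $ snd (es ! e) - x $ fst (es ! e))"
      using b[of "fst (es ! e)"] b[of "snd (es ! e)"] ends[OF e] \<epsilon>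
      by (intro mult_sin_nonneg) linarith
    then show ?thesis
      using e weight_nonneg[OF e] by (simp add: B_transpose_mult[OF carr] del: index_mult_mat_vec)
  qed
  then have "0 \<le> (\<Sum>i<n. x $ i * ((B * W) *\<^sub>v ?y) $ i)"
    unfolding quadratic_form[OF carr y] by (intro sum_nonneg) auto
  moreover have "(\<Sum>i<n. x $ i * edge_field B W x $ i) =
      (\<Sum>i<n. - (x $ i * sin (x $ i)) - x $ i * ((B * W) *\<^sub>v ?y) $ i)"
    by (intro sum.cong)
       (simp_all add: edge_field_index[OF carr] right_diff_distrib del: index_mult_mat_vec)
  then have "(\<Sum>i<n. x $ i * edge_field B W x $ i) =
      - (\<Sum>i<n. x $ i * sin (x $ i)) - (\<Sum>i<n. x $ i * ((B * W) *\<^sub>v ?y) $ i)"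
    by (simp only: sum_subtractf sum_negf)
  ultimately show ?thesis
    using sum_mult_sin_ge[OF x \<epsilon>] by linarith
qed

end

section \<open>Nonnegative couplings and assembly of the result\<close>

lemma coupling_nonneg:
  assumes "\<And>i. i < n \<Longrightarrow> 0 < r i" "\<And>i. i < n \<Longrightarrow> 0 < \<theta> i \<and> \<theta> i < pi" "i < n" "j < n"
  shows "0 \<le> coupling G r \<theta> i j"
proof -
  have "0 < r i * sin (\<theta> i)" "0 < r j * sin (\<theta> j)"
    using assms by (auto intro!: mult_pos_pos sin_gt_zero)
  then show ?thesis by (simp add: coupling_def adj_def)
qed

theorem mainTheorem2:
  fixes n :: nat and G :: "nat pair_pre_digraph" and es :: "(nat \<times> nat) list"
    and r \<theta> :: "nat \<Rightarrow> real" and a' :: "nat \<Rightarrow> nat \<Rightarrow> real"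
    and B W :: "real mat" and \<phi>t :: "real vec" and \<phi>star \<epsilon> \<sigma>1 \<sigma>2 \<mu> :: real
  assumes graph: "pair_graph G" "pverts G = {0..<n}" "Digraph_Component.connected (with_proj G)"
    and orientation: "oriented_edges G es"
    and Bloch: "\<And>i. i < n \<Longrightarrow> 0 < r i" "\<And>i. i < n \<Longrightarrow> 0 < \<theta> i \<and> \<theta> i < pi"
    and weights: "a' = coupling G r \<theta>"
    and pinner: "\<phi>t \<in> carrier_vec n" "\<And>i. i < n \<Longrightarrow> \<phi>t $ i = \<phi>star"
    and B: "B = incidence n es"
    and W: "edge_weight_matrix a' es W"
    and \<epsilon>: "0 \<le> \<epsilon>" "\<epsilon> < pi / 2"
    and \<sigma>: "\<sigma>1 = sinc \<epsilon>" "\<sigma>2 = sinc (2 * \<epsilon>)"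
    and \<mu>: "\<mu> = lambda_min (\<sigma>1 \<cdot>\<^sub>m 1\<^sub>m n + \<sigma>2 \<cdot>\<^sub>m (B * W * transpose_mat B))"
  shows
    "\<mu> > 0 \<and>
     positively_invariant n (phase_field n a' \<phi>t) {\<phi> \<in> carrier_vec n. \<phi> - \<phi>t \<in> cube n \<epsilon>} \<and>
     (\<forall>\<phi>. solution n (phase_field n a' \<phi>t) \<phi> \<and> max_deviation n (\<phi> 0 - \<phi>t) = \<epsilon> \<longrightarrow>
        ((\<forall>i<n. \<forall>j<n. a' i j = a' j i) \<longrightarrow> lyapunov_decay \<mu> (\<lambda>t. \<phi> t - \<phi>t)) \<and>
        exp_convergent n \<mu> (\<lambda>t. \<phi> t - \<phi>t)) \<and>
     positively_invariant n (edge_field B W) (cube n \<epsilon>) \<and>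
     (\<forall>\<zeta>. solution n (edge_field B W) \<zeta> \<and> max_deviation n (\<zeta> 0) = \<epsilon> \<longrightarrow>
        lyapunov_decay \<mu> \<zeta> \<and> exp_convergent n \<mu> \<zeta>)"
proof -
  interpret pair_graph G by (rule graph(1))
  \<comment> \<open>Connectedness of a digraph includes that its vertex set is nonempty.\<close>
  have n: "0 < n"
    using graph(2,3) by (cases n) (auto simp: Digraph_Component.connected_def strongly_connected_def)
  have a_nonneg: "0 \<le> a' i j" if "i < n" "j < n" for i j
    unfolding weights using Bloch that by (rule coupling_nonneg)
  have ends: "fst (es ! e) < n \<and> snd (es ! e) < n \<and> fst (es ! e) \<noteq> snd (es ! e)"
    if "e < length es" for e
  proof -
    have "es ! e \<in> parcs G"
      using orientation that by (auto simp: oriented_edges_def)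
    then show ?thesis
      using pair_no_loops arc_fst_in_verts arc_snd_in_verts graph(2) by fastforce
  qed
  obtain w where w: "W = mat_diag (length es) w"
    "\<And>e. e < length es \<Longrightarrow> w e = a' (fst (es ! e)) (snd (es ! e)) \<or> w e = a' (snd (es ! e)) (fst (es ! e))"
    using W by (auto simp: edge_weight_matrix_def)
  interpret wi: weighted_incidence n es w
    using ends a_nonneg w(2) by unfold_locales metis+
  \<comment> \<open>As 2\<epsilon> < pi, the factor \<sigma>2 is positive, so the Laplacian term
    cannot lower the smallest eigenvalue below \<sigma>1.\<close>
  have "0 < sinc (2 * \<epsilon>)"
    using \<epsilon> by (intro sinc_pos) auto
  then have \<mu>_eq: "\<mu> = sinc \<epsilon>"
    unfolding \<mu> B w(1) \<sigma> by (intro wi.lambda_min_eq n) simp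
  have \<mu>_pos: "0 < \<mu>"
    unfolding \<mu>_eq using \<epsilon> by (intro sinc_pos) auto
  define P where "P = phase_field n a' (0\<^sub>v n)"
  have P: "inward_field n P"
    unfolding P_def by (rule phase_field_inward[OF a_nonneg])
  have E: "inward_field n (edge_field B W)"
    unfolding B w(1) by (rule wi.edge_field_inward)
  have shift: "solution n P (\<lambda>t. \<phi> t - \<phi>t)" if "solution n (phase_field n a' \<phi>t) \<phi>" for \<phi>
    unfolding P_def by (rule phase_field_solution_shift[OF pinner that])
  have conv: "exp_convergent n \<mu> z"
    if "inward_field n F" "solution n F z" "max_deviation n (z 0) = \<epsilon>" for F z
    unfolding \<mu>_eq using that \<epsilon> max_deviation_cube[of "z 0" n]
    by (intro inward_field_exp_convergent[OF that(1)]) (auto simp: solution_def)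
  have decay: "lyapunov_decay \<mu> z"
    if F: "inward_field n F" and sol: "solution n F z" and init: "max_deviation n (z 0) = \<epsilon>"
      and dissip: "\<And>x. x \<in> cube n \<epsilon> \<Longrightarrow> (\<Sum>i<n. x $ i * F x $ i) \<le> - sinc \<epsilon> * (\<Sum>i<n. (x $ i)\<^sup>2)"
    for F z
  proof -
    have "z 0 \<in> cube n \<epsilon>"
      using sol init max_deviation_cube[of "z 0" n] by (auto simp: solution_def)
    \<comment> \<open>Invariance keeps the whole trajectory in the initial cube, the region where
      the dissipation inequality is available.\<close>
    then have "z t \<in> cube n \<epsilon>" if "0 \<le> t" for t
      using inward_field_positively_invariant[OF F \<epsilon>] sol that
      by (auto simp: positively_invariant_def)
    then show ?thesis
      unfolding \<mu>_eq by (rule lyapunov_decayI[OF sol _ dissip])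
  qed
  show ?thesis
  proof (intro conjI allI impI; (elim conjE)?)
    show "positively_invariant n (phase_field n a' \<phi>t) {\<phi> \<in> carrier_vec n. \<phi> - \<phi>t \<in> cube n \<epsilon>}"
      unfolding positively_invariant_def
    proof (intro allI impI)
      fix \<phi> :: "real \<Rightarrow> real vec" and t :: real
      assume "solution n (phase_field n a' \<phi>t) \<phi>"
        "\<phi> 0 \<in> {\<phi> \<in> carrier_vec n. \<phi> - \<phi>t \<in> cube n \<epsilon>}" "0 \<le> t"
      then show "\<phi> t \<in> {\<phi> \<in> carrier_vec n. \<phi> - \<phi>t \<in> cube n \<epsilon>}"
        using inward_field_positively_invariant[OF P \<epsilon>] shift[of \<phi>]
        by (auto simp: positively_invariant_def solution_def)
    qed
  next
    fix \<phi>
    assume sol: "solution n (phase_field n a' \<phi>t) \<phi>" and init: "max_deviation n (\<phi> 0 - \<phi>t) = \<epsilon>"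
    show "exp_convergent n \<mu> (\<lambda>t. \<phi> t - \<phi>t)"
      by (rule conv[OF P shift[OF sol] init])
    assume sym: "\<forall>i<n. \<forall>j<n. a' i j = a' j i"
    show "lyapunov_decay \<mu> (\<lambda>t. \<phi> t - \<phi>t)"
      using sym \<epsilon> a_nonneg unfolding P_def
      by (intro decay[OF P shift[OF sol] init, unfolded P_def] phase_field_dissipation) auto
  next
    fix \<zeta>
    assume sol: "solution n (edge_field B W) \<zeta>" and init: "max_deviation n (\<zeta> 0) = \<epsilon>"
    show "exp_convergent n \<mu> \<zeta>"
      by (rule conv[OF E sol init])
    show "lyapunov_decay \<mu> \<zeta>"
      using wi.edge_field_dissipation[OF _ \<epsilon>(2)] unfolding B w(1)
      by (intro decay[OF E sol init, unfolded B w(1)])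
  qed (use \<mu>_pos inward_field_positively_invariant[OF E \<epsilon>] in auto)
qed

end
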